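(* Let $n\ge 4$ be an integer. There is no set $S\subseteq\mathbb{R}^n$ that meets every isometric copy of $\mathbb{Z}^n$ in $\mathbb{R}^n$ in exactly one point.
   Context: An isometric copy of $\mathbb{Z}^n$ in $\mathbb{R}^n$ is the image of $\mathbb{Z}^n$ under an isometry of the Euclidean space $\mathbb{R}^n$. *)

theory Defs
  imports "HOL-Analysis.Analysis"
begin

definition isometry :: "('a::metric_space \<Rightarrow> 'b::metric_space) \<Rightarrow> bool" where
  "isometry f \<longleftrightarrow> bij f \<and> (\<forall>x y. dist (f x) (f y) = dist x y)"

definition int_lattice :: "(real ^ 'n) set" where
  "int_lattice = {x. \<forall>i. x $ i \<in> \<int>}"

definition isometric_copy :: "(real ^ 'n) set \<Rightarrow> bool" where
  "isometric_copy L \<longleftrightarrow> (\<exists>f :: real ^ 'n \<Rightarrow> real ^ 'n. isometry f \<and> L = f ` int_lattice)"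

end

theory Submission
  imports Defs
begin

text \<open>
  The obstruction is a triangle. Let \<open>h\<close> have four coordinates equal to \<open>1/2\<close> and the others
  equal to \<open>0\<close>, so that \<open>h\<close> is a unit vector, and consider the three disjoint sets
  \<^item> \<open>D\<close>, the integer points \<open>x\<close> with \<open>x \<bullet> h \<in> \<int>\<close>,
  \<^item> \<open>A\<close>, the points \<open>x\<close> of \<open>h + \<int>\<^sup>n\<close> with \<open>x \<bullet> h \<in> \<int>\<close>,
  \<^item> \<open>B\<close>, the points \<open>x\<close> of \<open>h + \<int>\<^sup>n\<close> with \<open>x \<bullet> h \<in> \<int> + 1/2\<close>.

  The union of any two of them is an isometric copy of \<open>\<int>\<^sup>n\<close>: \<open>A \<union> B\<close> is the translate
  \<open>h + \<int>\<^sup>n\<close>, while \<open>D \<union> B\<close> and \<open>D \<union> A\<close> are the mirror images of \<open>\<int>\<^sup>n\<close> in the hyperplanes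
  orthogonal to \<open>h\<close> and to \<open>h - e\<close>, where \<open>e\<close> is a standard basis vector in the support of
  \<open>h\<close>. (In dimension four, \<open>D\<close> is the root lattice \<open>D\<^sub>4\<close>, and \<open>A\<close>, \<open>B\<close> are two of its three
  nontrivial cosets in the dual lattice; triality permutes these three.) A set meeting each of
  the three unions in exactly one point would have \<open>a\<close>, \<open>b\<close>, \<open>d\<close> points in \<open>A\<close>, \<open>B\<close>, \<open>D\<close>
  with \<open>a + b = d + b = d + a = 1\<close>, hence \<open>2 * (a + b + d) = 3\<close>, which is impossible.
\<close>

lemma half_not_Ints: "(1/2 :: real) \<notin> \<int>"
proof
  assume "(1/2 :: real) \<in> \<int>"
  then obtain k :: int where "1/2 = real_of_int k" by (auto elim: Ints_cases)
  then have "real_of_int (2 * k) = real_of_int 1" by simp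
  then have "2 * k = 1" by (simp only: of_int_eq_iff)
  then show False by presburger
qed

lemma Ints_double_cases:
  fixes z :: real
  assumes "2 * z \<in> \<int>"
  shows "z \<in> \<int> \<or> z + 1/2 \<in> \<int>"
proof -
  obtain k :: int where k: "2 * z = real_of_int k" using assms by (auto elim: Ints_cases)
  show ?thesis
  proof (cases "even k")
    case True
    then obtain m where "k = 2 * m" by blast
    then have "z = real_of_int m" using k by simp
    then show ?thesis by simp
  next
    case False
    then obtain m where "k = 2 * m + 1" using oddE by blast
    then have "z + 1/2 = real_of_int (m + 1)" using k by simp
    then show ?thesis by (metis Ints_of_int)
  qed
qed

lemma Ints_cong:
  fixes a b :: real
  assumes "a - b \<in> \<int>"
  shows "a \<in> \<int> \<longleftrightarrow> b \<in> \<int>"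
proof
  show "b \<in> \<int>" if "a \<in> \<int>" using Ints_diff[OF that assms] by simp
  show "a \<in> \<int>" if "b \<in> \<int>" using Ints_add[OF assms that] by simp
qed

lemma int_lattice_cong:
  assumes "x - y \<in> int_lattice"
  shows "x \<in> int_lattice \<longleftrightarrow> y \<in> int_lattice"
proof -
  have "x $ i \<in> \<int> \<longleftrightarrow> y $ i \<in> \<int>" for i
    using assms by (intro Ints_cong) (simp add: int_lattice_def)
  then show ?thesis by (simp add: int_lattice_def)
qed

lemma int_lattice_diff: "x \<in> int_lattice \<Longrightarrow> y \<in> int_lattice \<Longrightarrow> x - y \<in> int_lattice"
  by (simp add: int_lattice_def)

lemma int_lattice_scale: "c \<in> \<int> \<Longrightarrow> x \<in> int_lattice \<Longrightarrow> c *\<^sub>R x \<in> int_lattice"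
  by (simp add: int_lattice_def)

lemma int_lattice_inner: "x \<in> int_lattice \<Longrightarrow> y \<in> int_lattice \<Longrightarrow> x \<bullet> y \<in> \<int>"
  by (auto simp: int_lattice_def inner_vec_def intro!: Ints_sum Ints_mult)

lemma isometric_copy_translate:
  fixes h :: "real ^ 'n"
  shows "isometric_copy {x. x - h \<in> int_lattice}"
  unfolding isometric_copy_def
proof (intro exI conjI)
  show "isometry (\<lambda>x. x + h)"
    unfolding isometry_def by (simp add: bij_plus_right dist_norm)
  show "{x. x - h \<in> int_lattice} = (\<lambda>x. x + h) ` int_lattice"
  proof (intro set_eqI iffI)
    fix x assume "x \<in> {x. x - h \<in> int_lattice}"
    then show "x \<in> (\<lambda>x. x + h) ` int_lattice" by (intro image_eqI[of _ _ "x - h"]) auto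
  qed auto
qed

text \<open>
  The reflection \<open>x \<mapsto> x - 2 (x \<bullet> w) w\<close> is an involution, so \<open>x\<close> lies in the mirror image of the
  integer lattice iff its reflection is an integer point. As \<open>2 w\<close> is integral, \<open>2 (x \<bullet> w)\<close>
  is then an integer, and subtracting \<open>2 (x \<bullet> w) w\<close> amounts, modulo integer points, to
  subtracting nothing or \<open>w\<close> according to its parity.
\<close>
lemma isometric_copy_reflection:
  fixes w :: "real ^ 'n"
  assumes unit: "w \<bullet> w = 1" and half: "2 *\<^sub>R w \<in> int_lattice"
  shows "isometric_copy
    ({x \<in> int_lattice. x \<bullet> w \<in> \<int>} \<union> {x. x - w \<in> int_lattice \<and> x \<bullet> w + 1/2 \<in> \<int>})"
    (is "isometric_copy ?M")
proof -
  define f where "f = (\<lambda>x. x - (2 * (x \<bullet> w)) *\<^sub>R w)"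
  have inv: "f (f x) = x" for x
    by (simp add: f_def inner_diff_left unit algebra_simps)
  have inner_f: "f x \<bullet> w = - (x \<bullet> w)" for x
    by (simp add: f_def inner_diff_left unit)
  have f_diff: "f x - f y = f (x - y)" for x y
    by (simp add: f_def inner_diff_left algebra_simps)
  have "f x \<bullet> f x = x \<bullet> x" for x
    by (simp add: f_def inner_diff_left inner_diff_right unit inner_commute)
  then have norm_f: "norm (f x) = norm x" for x
    by (simp add: norm_eq_sqrt_inner)
  have iso: "isometry f"
    unfolding isometry_def
  proof (intro conjI allI)
    show "bij f" using inv by (rule involuntory_imp_bij)
    show "dist (f x) (f y) = dist x y" for x y
      by (simp add: dist_norm f_diff norm_f)
  qed
  have mem: "f x \<in> int_lattice \<longleftrightarrow> x \<in> ?M" for x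
  proof (cases "x \<bullet> w \<in> \<int>")
    case True
    have shift: "(2 * (x \<bullet> w)) *\<^sub>R w \<in> int_lattice"
      using int_lattice_scale[OF True half] by (simp add: mult.commute)
    have "x \<bullet> w + 1/2 \<notin> \<int>"
      using Ints_cong[of "x \<bullet> w + 1/2" "1/2"] True half_not_Ints by simp
    moreover have "f x \<in> int_lattice \<longleftrightarrow> x \<in> int_lattice"
      using int_lattice_cong[of x "f x"] shift by (simp add: f_def)
    ultimately show ?thesis using True by auto
  next
    case not_int: False
    show ?thesis
    proof (cases "x \<bullet> w + 1/2 \<in> \<int>")
      case True
      have "(x \<bullet> w + 1/2 - 1) *\<^sub>R 2 *\<^sub>R w \<in> int_lattice"
        by (intro int_lattice_scale half Ints_diff True) simp
      then have shift: "(2 * (x \<bullet> w)) *\<^sub>R w - w \<in> int_lattice"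
        by (simp add: algebra_simps)
      have "f x \<in> int_lattice \<longleftrightarrow> x - w \<in> int_lattice"
        using int_lattice_cong[of "x - w" "f x"] shift by (simp add: f_def)
      then show ?thesis using True not_int by auto
    next
      case False
      have "2 * (x \<bullet> w) \<in> \<int>" if "f x \<in> int_lattice"
      proof -
        have "f x \<bullet> (2 *\<^sub>R w) \<in> \<int>" using that half by (rule int_lattice_inner)
        then show ?thesis by (simp add: inner_f minus_in_Ints_iff)
      qed
      then show ?thesis using False not_int Ints_double_cases by blast
    qed
  qed
  have "?M = f ` int_lattice"
  proof (intro set_eqI iffI)
    fix x
    show "x \<in> f ` int_lattice" if "x \<in> ?M"
      using that mem[of x] inv[of x] by (metis image_eqI)
    show "x \<in> ?M" if "x \<in> f ` int_lattice"
      using that mem[of x] inv by (metis imageE)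
  qed
  then show ?thesis using iso unfolding isometric_copy_def by blast
qed

text \<open>The vector \<open>h\<close> has norm one because it has exactly four coordinates \<open>1/2\<close>; this is the
  only place where the dimension matters.\<close>
lemma half_integral_unit_vector:
  assumes "CARD('n::finite) \<ge> 4"
  obtains h :: "real ^ 'n" and i :: 'n
  where "h \<bullet> h = 1" "2 *\<^sub>R h \<in> int_lattice" "h $ i = 1/2"
proof -
  obtain I :: "'n set" where I: "card I = 4"
    using obtain_subset_with_card_n[OF assms] by metis
  then obtain i where i: "i \<in> I" by fastforce
  define h :: "real ^ 'n" where "h = (\<chi> j. if j \<in> I then 1/2 else 0)"
  have "h \<bullet> h = (\<Sum>j\<in>UNIV. if j \<in> I then 1/4 else 0)"
    unfolding inner_vec_def by (rule sum.cong) (auto simp: h_def)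
  also have "\<dots> = 1" by (simp add: sum.If_cases I)
  finally have "h \<bullet> h = 1" .
  moreover have "2 *\<^sub>R h \<in> int_lattice" by (simp add: int_lattice_def h_def)
  moreover have "h $ i = 1/2" using i by (simp add: h_def)
  ultimately show ?thesis by (rule that)
qed

lemma no_transversal_of_triangle:
  assumes "A \<inter> B = {}" "D \<inter> B = {}" "D \<inter> A = {}"
    and "\<exists>!x. x \<in> S \<inter> (A \<union> B)" "\<exists>!x. x \<in> S \<inter> (D \<union> B)" "\<exists>!x. x \<in> S \<inter> (D \<union> A)"
  shows False
proof -
  have one: "(S \<inter> P = {}) \<noteq> (S \<inter> Q = {})"
    if PQ: "P \<inter> Q = {}" and ex: "\<exists>!x. x \<in> S \<inter> (P \<union> Q)" for P Q
  proof -
    obtain x where x: "x \<in> S" "x \<in> P \<or> x \<in> Q"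
      and unique: "\<And>y. y \<in> S \<Longrightarrow> y \<in> P \<or> y \<in> Q \<Longrightarrow> y = x"
      using ex unfolding Ex1_def Int_iff Un_iff by blast
    from x(2) show ?thesis
    proof
      assume P: "x \<in> P"
      then have "S \<inter> Q = {}" using PQ unique by (metis disjoint_iff)
      then show ?thesis using x(1) P by auto
    next
      assume Q: "x \<in> Q"
      then have "S \<inter> P = {}" using PQ unique by (metis disjoint_iff)
      then show ?thesis using x(1) Q by auto
    qed
  qed
  have "(S \<inter> A = {}) \<noteq> (S \<inter> B = {})" using assms(1,4) by (rule one)
  moreover have "(S \<inter> D = {}) \<noteq> (S \<inter> B = {})" using assms(2,5) by (rule one)
  moreover have "(S \<inter> D = {}) \<noteq> (S \<inter> A = {})" using assms(3,6) by (rule one)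
  ultimately show False by blast
qed

theorem mainTheorem2:
  assumes "CARD('n::finite) \<ge> 4"
  shows "\<nexists>S :: (real ^ 'n) set. \<forall>L :: (real ^ 'n) set. isometric_copy L \<longrightarrow> (\<exists>!x. x \<in> S \<inter> L)"
proof
  assume "\<exists>S :: (real ^ 'n) set. \<forall>L :: (real ^ 'n) set. isometric_copy L \<longrightarrow> (\<exists>!x. x \<in> S \<inter> L)"
  then obtain S :: "(real ^ 'n) set"
    where S: "\<And>L. isometric_copy L \<Longrightarrow> \<exists>!x. x \<in> S \<inter> L" by blast
  obtain h :: "real ^ 'n" and i :: 'n
    where unit: "h \<bullet> h = 1" and half: "2 *\<^sub>R h \<in> int_lattice" and hi: "h $ i = 1/2"
    using half_integral_unit_vector[OF assms] .
  define D where "D = {x \<in> int_lattice. x \<bullet> h \<in> \<int>}"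
  define A where "A = {x. x - h \<in> int_lattice \<and> x \<bullet> h \<in> \<int>}"
  define B where "B = {x. x - h \<in> int_lattice \<and> x \<bullet> h + 1/2 \<in> \<int>}"

  have AB: "A \<union> B = {x. x - h \<in> int_lattice}"
  proof -
    have "x \<bullet> h \<in> \<int> \<or> x \<bullet> h + 1/2 \<in> \<int>" if "x - h \<in> int_lattice" for x
    proof (rule Ints_double_cases)
      have "(x - h) \<bullet> (2 *\<^sub>R h) \<in> \<int>" using that half by (rule int_lattice_inner)
      then have "(x - h) \<bullet> (2 *\<^sub>R h) + 2 \<in> \<int>" by simp
      then show "2 * (x \<bullet> h) \<in> \<int>" by (simp add: inner_diff_left unit)
    qed
    then show ?thesis by (auto simp: A_def B_def)
  qed
  have copy_DB: "isometric_copy (D \<union> B)"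
    unfolding D_def B_def using unit half by (rule isometric_copy_reflection)

  \<comment> \<open>Replacing \<open>h\<close> by \<open>h - e\<close> changes the sign of one coordinate \<open>1/2\<close>, which keeps the norm and
    the class modulo integer points. The product with \<open>x\<close> drops by \<open>x $ i\<close>, an integer on
    \<open>D\<close> but a half-integer on \<open>h + \<int>\<^sup>n\<close>, so the reflection picks \<open>A\<close> instead of \<open>B\<close>.\<close>
  define u where "u = h - axis i 1"
  have inner_u: "x \<bullet> u = x \<bullet> h - x $ i" for x
    by (simp add: u_def inner_diff_right inner_axis)
  have axis: "axis i 1 \<in> (int_lattice :: (real ^ 'n) set)"
    by (simp add: int_lattice_def axis_def)
  have "u $ i = - 1/2" by (simp add: u_def hi)
  moreover have "u \<bullet> h = 1/2" by (simp add: inner_commute[of u] inner_u unit hi)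
  ultimately have "u \<bullet> u = 1" by (simp add: inner_u)
  moreover have "2 *\<^sub>R u \<in> int_lattice"
    using int_lattice_diff[OF half int_lattice_scale[OF _ axis, of 2]]
    by (simp add: u_def scaleR_diff_right)
  ultimately have "isometric_copy
    ({x \<in> int_lattice. x \<bullet> u \<in> \<int>} \<union> {x. x - u \<in> int_lattice \<and> x \<bullet> u + 1/2 \<in> \<int>})"
    by (rule isometric_copy_reflection)
  moreover have "x \<in> int_lattice \<and> x \<bullet> u \<in> \<int> \<longleftrightarrow> x \<in> D" for x
  proof -
    have "x \<bullet> u \<in> \<int> \<longleftrightarrow> x \<bullet> h \<in> \<int>" if "x $ i \<in> \<int>"
      using Ints_cong[of "x \<bullet> h" "x \<bullet> u"] that by (simp add: inner_u)
    then show ?thesis by (auto simp: D_def int_lattice_def)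
  qed
  moreover have "x - u \<in> int_lattice \<and> x \<bullet> u + 1/2 \<in> \<int> \<longleftrightarrow> x \<in> A" for x
  proof -
    have "x - u \<in> int_lattice \<longleftrightarrow> x - h \<in> int_lattice"
      using int_lattice_cong[of "x - u" "x - h"] axis by (simp add: u_def)
    moreover have "x \<bullet> u + 1/2 \<in> \<int> \<longleftrightarrow> x \<bullet> h \<in> \<int>" if "x - h \<in> int_lattice"
    proof -
      have "(x - h) $ i \<in> \<int>" using that by (simp add: int_lattice_def)
      moreover have "(x - h) $ i = x \<bullet> h - (x \<bullet> u + 1/2)" by (simp add: inner_u hi)
      ultimately have "x \<bullet> h - (x \<bullet> u + 1/2) \<in> \<int>" by (simp only:)
      then show ?thesis using Ints_cong by blast
    qed
    ultimately show ?thesis by (auto simp: A_def)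
  qed
  ultimately have copy_DA: "isometric_copy (D \<union> A)"
    by (simp add: Un_def)

  have disj_AB: "A \<inter> B = {}"
  proof -
    have "x \<bullet> h + 1/2 \<notin> \<int>" if "x \<bullet> h \<in> \<int>" for x
      using Ints_cong[of "x \<bullet> h + 1/2" "1/2"] that half_not_Ints by simp
    then show ?thesis by (auto simp: A_def B_def)
  qed
  have disj_D: "x \<notin> D" if "x - h \<in> int_lattice" for x
  proof
    assume "x \<in> D"
    then have "x \<in> int_lattice" by (simp add: D_def)
    from int_lattice_diff[OF this that] have "h $ i \<in> \<int>" by (simp add: int_lattice_def)
    then show False using hi half_not_Ints by simp
  qed
  show False
  proof (rule no_transversal_of_triangle)
    show "A \<inter> B = {}" by (rule disj_AB)
    show "D \<inter> B = {}" "D \<inter> A = {}" using disj_D by (auto simp: A_def B_def)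
    show "\<exists>!x. x \<in> S \<inter> (A \<union> B)" unfolding AB by (intro S isometric_copy_translate)
    show "\<exists>!x. x \<in> S \<inter> (D \<union> B)" "\<exists>!x. x \<in> S \<inter> (D \<union> A)" by (intro S copy_DB copy_DA)+
  qed
qed

end
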